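(* There is an improved version of the standard method for factoring simple summand-reducible polynomials in $S=\mathbb{R}[x_1,\dots,x_n]$ (the improved method described in the context) which produces, for every simple summand-reducible polynomial $f$, a matrix factorization of $f$ whose size is at most one-half the size of the matrix factorization of $f$ one obtains with the standard method.
   Context: A matrix factorization of $f\in S$ of size $N$ is a pair $(\phi,\psi)$ of $N\times N$ matrices over $S$ with $\phi\psi=\psi\phi=fI_N$. Simple summand-reducible: $f$ can be written as $f=g_1h_1+\cdots+g_kh_k$, $k\ge2$, where: (1) for at least one $i$, $g_ih_i$ is a product of two polynomials such that, with $n_{g_i}$, $n_{h_i}$ the numbers of monomials in $g_i$, $h_i$, one has $n_{g_i}n_{h_i}\ge6$; (2) if for some $i$ the expanded form of $g_ih_i$ belongs to $\{a^m-b^m,\ a^m+b^m,\ a^2\pm2ab+b^2;\ m\in\mathbb{N}\setminus\{0\}\}$ (where $a$, $b$ are single variables or products of variables), then $g_ih_i$ is instead expanded to have a smaller expression. Such a form of $f$ is called simple summand-reduced. Expanded form: in counting the monomials of $f$ in expanded form, the products $g_ih_i$ of the simple summand-reduced form are multiplied out without collecting like terms, so $g_ih_i$ contributes $n_{g_i}n_{h_i}$ monomials. Standard method: for $P=a_1b_1+\cdots+a_Nb_N$ put $(C_1,D_1)=([a_1],[b_1])$ and, inductively, $$C_i=\begin{pmatrix}C_{i-1}&-a_iI\\ b_iI&D_{i-1}\end{pmatrix},\qquad D_i=\begin{pmatrix}D_{i-1}&a_iI\\ -b_iI&C_{i-1}\end{pmatrix};$$ $(C_N,D_N)$ is a matrix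 factorization of $P$ of size $2^{N-1}$. The standard method is applied to a polynomial in expanded form, each $a_ib_i$ being one monomial; so it gives size $2^{N-1}$ for a polynomial with $N$ monomials in expanded form. Tensor products ($\otimes$ is the Kronecker product of matrices): for a size-$n$ factorization $X=(\phi,\psi)$ of $u\in S$ and a size-$m$ factorization $X'=(\phi',\psi')$ of $v\in S$, $$X\widetilde{\otimes}X'=\left(\begin{bmatrix}\phi\otimes\phi'&0\\0&\phi\otimes\phi'\end{bmatrix},\begin{bmatrix}\psi\otimes\psi'&0\\0&\psi\otimes\psi'\end{bmatrix}\right)$$ is a factorization of $uv$ of size $2nm$, and $$X\widehat{\otimes}X'=\left(\begin{bmatrix}\phi\otimes1_m&1_n\otimes\phi'\\-1_n\otimes\psi'&\psi\otimes1_m\end{bmatrix},\begin{bmatrix}\psi\otimes1_m&-1_n\otimes\phi'\\1_n\otimes\psi'&\phi\otimes1_m\end{bmatrix}\right)$$ (Yoshino's tensor product) is a factorization of $u+v$ of size $2nm$. Improved method for $f=g_1h_1+\cdots+g_kh_k$ in simple summand-reduced form: for each $i$, if $g_ih_i$ is a product of sums of monomials (both $g_i$ and $h_i$ have at least two monomials), apply the standard method to $g_i$ and to $h_i$ and combine the two results by $\widetilde{\otimes}$ into a factorization of $g_ih_i$; otherwise use the $1\times1$ factorization $([g_i],[h_i])$ of $g_ih_i$. Then combine the factorizations of $g_1h_1,\dots,g_kh_k$ successively by $\widehat{\otimes}$ into a factorization of $f$. *)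

theory Defs
  imports "HOL-Library.Poly_Mapping" "HOL-Library.Multiset" "Jordan_Normal_Form.Matrix"
begin

text \<open>The ring \<open>\<real>[x\<^sub>1, \<dots>, x\<^sub>n]\<close>: the variables are the elements of the finite type \<open>'n\<close>
  (so \<open>n = CARD('n)\<close>), a polynomial maps exponent vectors to coefficients.\<close>

type_synonym 'n mpoly = "('n \<Rightarrow>\<^sub>0 nat) \<Rightarrow>\<^sub>0 real"

definition num_monomials :: "'n mpoly \<Rightarrow> nat" where
  "num_monomials g = card (Poly_Mapping.keys g)"

definition term_of :: "'n mpoly \<Rightarrow> ('n \<Rightarrow>\<^sub>0 nat) \<Rightarrow> 'n mpoly" where
  "term_of g m = Poly_Mapping.single m (Poly_Mapping.lookup g m)"

definition monomials :: "'n mpoly \<Rightarrow> 'n mpoly multiset" where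
  "monomials g = image_mset (term_of g) (mset_set (Poly_Mapping.keys g))"

text \<open>Multiplying out without collecting like terms: one monomial for each pair of monomials,
  with repetitions and cancelling pairs kept.\<close>

definition product_monomials :: "'n mpoly \<Rightarrow> 'n mpoly \<Rightarrow> 'n mpoly multiset" where
  "product_monomials g h =
     image_mset (\<lambda>(m, m'). term_of g m * term_of h m')
       (mset_set (Poly_Mapping.keys g \<times> Poly_Mapping.keys h))"

definition expanded_form :: "('n mpoly \<times> 'n mpoly) list \<Rightarrow> 'n mpoly multiset" where
  "expanded_form F = (\<Sum>(g, h)\<leftarrow>F. product_monomials g h)"

definition var_products :: "'n mpoly set" where
  "var_products = {Poly_Mapping.single m 1 | m. m \<noteq> 0}"

text \<open>The case \<open>a = b\<close> is left out: it would only yield \<open>0\<close> and the single monomials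
  \<open>2a\<^sup>m\<close> and \<open>4a\<^sup>2\<close>.\<close>

definition special_expansions :: "'n mpoly set" where
  "special_expansions =
     {p. \<exists>a \<in> var_products. \<exists>b \<in> var_products. a \<noteq> b \<and>
        ((\<exists>m::nat. m \<noteq> 0 \<and> (p = a ^ m - b ^ m \<or> p = a ^ m + b ^ m))
         \<or> p = a\<^sup>2 + 2 * a * b + b\<^sup>2 \<or> p = a\<^sup>2 - 2 * a * b + b\<^sup>2)}"

text \<open>A form \<open>g\<^sub>1h\<^sub>1 + \<dots> + g\<^sub>kh\<^sub>k\<close> is the list of the pairs \<open>(g\<^sub>i, h\<^sub>i)\<close>; a single
  monomial is a summand whose two factors have one monomial each. Zero factors are excluded,
  since otherwise summands \<open>0h\<close> could be added at will. The last conjunct says that a summand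
  with a special expansion is written in an expanded way, that is, multiplying it out
  does not reduce its number of monomials (\<open>(x + y)(x\<^sup>2 - xy + y\<^sup>2)\<close> is not allowed,
  \<open>1(x\<^sup>3 + y\<^sup>3)\<close> or the two summands \<open>xx\<^sup>2\<close>, \<open>yy\<^sup>2\<close> are).\<close>

definition simple_summand_reduced_form ::
    "'n mpoly \<Rightarrow> ('n mpoly \<times> 'n mpoly) list \<Rightarrow> bool" where
  "simple_summand_reduced_form f F \<longleftrightarrow>
     length F \<ge> 2 \<and>
     f = (\<Sum>(g, h)\<leftarrow>F. g * h) \<and>
     (\<forall>(g, h) \<in> set F. g \<noteq> 0 \<and> h \<noteq> 0) \<and>
     (\<exists>(g, h) \<in> set F. num_monomials g * num_monomials h \<ge> 6) \<and>
     (\<forall>(g, h) \<in> set F. g * h \<in> special_expansions \<longrightarrow>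
        \<not> num_monomials (g * h) < num_monomials g * num_monomials h)"

definition simple_summand_reducible :: "'n mpoly \<Rightarrow> bool" where
  "simple_summand_reducible f \<longleftrightarrow> (\<exists>F. simple_summand_reduced_form f F)"

definition matrix_factorization ::
    "'a::comm_ring_1 \<Rightarrow> nat \<Rightarrow> 'a mat \<times> 'a mat \<Rightarrow> bool" where
  "matrix_factorization f N X \<longleftrightarrow> (case X of (\<phi>, \<psi>) \<Rightarrow>
     \<phi> \<in> carrier_mat N N \<and> \<psi> \<in> carrier_mat N N \<and>
     \<phi> * \<psi> = f \<cdot>\<^sub>m 1\<^sub>m N \<and> \<psi> * \<phi> = f \<cdot>\<^sub>m 1\<^sub>m N)"

definition factorization_1x1 :: "'a \<Rightarrow> 'a \<Rightarrow> 'a mat \<times> 'a mat" where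
  "factorization_1x1 a b = (mat 1 1 (\<lambda>_. a), mat 1 1 (\<lambda>_. b))"

definition kronecker :: "'a::comm_ring_1 mat \<Rightarrow> 'a mat \<Rightarrow> 'a mat" where
  "kronecker A B =
     mat (dim_row A * dim_row B) (dim_col A * dim_col B)
       (\<lambda>(i, j). A $$ (i div dim_row B, j div dim_col B) * B $$ (i mod dim_row B, j mod dim_col B))"

definition mult_tensor ::
    "'a::comm_ring_1 mat \<times> 'a mat \<Rightarrow> 'a mat \<times> 'a mat \<Rightarrow> 'a mat \<times> 'a mat" where
  "mult_tensor X X' = (case (X, X') of ((\<phi>, \<psi>), (\<phi>', \<psi>')) \<Rightarrow>
     let A = kronecker \<phi> \<phi>'; B = kronecker \<psi> \<psi>';
         Z = 0\<^sub>m (dim_row \<phi> * dim_row \<phi>') (dim_row \<phi> * dim_row \<phi>')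
     in (four_block_mat A Z Z A, four_block_mat B Z Z B))"

definition yoshino_tensor ::
    "'a::comm_ring_1 mat \<times> 'a mat \<Rightarrow> 'a mat \<times> 'a mat \<Rightarrow> 'a mat \<times> 'a mat" where
  "yoshino_tensor X X' = (case (X, X') of ((\<phi>, \<psi>), (\<phi>', \<psi>')) \<Rightarrow>
     let n = dim_row \<phi>; m = dim_row \<phi>'
     in (four_block_mat (kronecker \<phi> (1\<^sub>m m)) (kronecker (1\<^sub>m n) \<phi>')
                        (kronecker (- 1\<^sub>m n) \<psi>') (kronecker \<psi> (1\<^sub>m m)),
         four_block_mat (kronecker \<psi> (1\<^sub>m m)) (kronecker (- 1\<^sub>m n) \<phi>')
                        (kronecker (1\<^sub>m n) \<psi>') (kronecker \<phi> (1\<^sub>m m))))"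

definition standard_step ::
    "'a::comm_ring_1 mat \<times> 'a mat \<Rightarrow> 'a \<times> 'a \<Rightarrow> 'a mat \<times> 'a mat" where
  "standard_step X p = (case (X, p) of ((C, D), (a, b)) \<Rightarrow>
     let I = 1\<^sub>m (dim_row C)
     in (four_block_mat C (- a \<cdot>\<^sub>m I) (b \<cdot>\<^sub>m I) D,
         four_block_mat D (a \<cdot>\<^sub>m I) (- b \<cdot>\<^sub>m I) C))"

text \<open>The factorization \<open>(C\<^sub>N, D\<^sub>N)\<close> of \<open>a\<^sub>1b\<^sub>1 + \<dots> + a\<^sub>Nb\<^sub>N\<close>, used for \<open>N \<ge> 1\<close> only.\<close>

definition standard_matrices :: "('a::comm_ring_1 \<times> 'a) list \<Rightarrow> 'a mat \<times> 'a mat" where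
  "standard_matrices ps =
     foldl standard_step (factorization_1x1 (fst (hd ps)) (snd (hd ps))) (tl ps)"

text \<open>The standard method leaves open the order of the monomials and how each of them is split
  as \<open>a\<^sub>jb\<^sub>j\<close>, so both methods are relations between their input and their possible results.\<close>

definition standard_method :: "'n mpoly multiset \<Rightarrow> 'n mpoly mat \<times> 'n mpoly mat \<Rightarrow> bool" where
  "standard_method T X \<longleftrightarrow>
     (\<exists>ps. mset (map (\<lambda>(a, b). a * b) ps) = T \<and> X = standard_matrices ps)"

definition summand_method ::
    "'n mpoly \<times> 'n mpoly \<Rightarrow> 'n mpoly mat \<times> 'n mpoly mat \<Rightarrow> bool" where
  "summand_method p X \<longleftrightarrow> (case p of (g, h) \<Rightarrow>
     if num_monomials g \<ge> 2 \<and> num_monomials h \<ge> 2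
     then (\<exists>U V. standard_method (monomials g) U \<and> standard_method (monomials h) V \<and>
             X = mult_tensor U V)
     else X = factorization_1x1 g h)"

definition improved_method ::
    "('n mpoly \<times> 'n mpoly) list \<Rightarrow> 'n mpoly mat \<times> 'n mpoly mat \<Rightarrow> bool" where
  "improved_method F X \<longleftrightarrow>
     (\<exists>Xs. list_all2 summand_method F Xs \<and> X = foldl yoshino_tensor (hd Xs) (tl Xs))"

end

theory Submission
  imports Defs
begin

text \<open>Both methods give factorizations whose sizes are powers of two, so the claim is a
  comparison of exponents. If the exponent of the factorization of \<open>g\<^sub>ih\<^sub>i\<close> is \<open>e\<^sub>i\<close>, then each
  application of Yoshino's product adds one to the sum of the exponents, and the improved method
  has size \<open>2 ^ (\<Sum>\<^sub>i (e\<^sub>i + 1) - 1)\<close>. The standard method has size \<open>2 ^ (\<Sum>\<^sub>i n\<^sub>g n\<^sub>h - 1)\<close>, where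
  \<open>n\<^sub>g\<close> and \<open>n\<^sub>h\<close> are the numbers of monomials of \<open>g\<^sub>i\<close> and \<open>h\<^sub>i\<close>. So it is enough that
  \<open>e\<^sub>i + 1 \<le> n\<^sub>g n\<^sub>h\<close> for every \<open>i\<close>, strictly for one \<open>i\<close>: then the two
  exponents differ by at least one, which is the factor \<open>1/2\<close> (lemmas \<open>Suc_summand_exponent_le\<close> and
  \<open>Suc_summand_exponent_less\<close>). If one factor is a monomial, \<open>e\<^sub>i + 1 = 1\<close>. Otherwise
  \<open>e\<^sub>i + 1 = n\<^sub>g + n\<^sub>h\<close>, which differs from \<open>n\<^sub>g n\<^sub>h\<close> by \<open>(n\<^sub>g - 1) (n\<^sub>h - 1) - 1\<close>; this is zero
  for \<open>n\<^sub>g = n\<^sub>h = 2\<close> only, and the summand with \<open>n\<^sub>g n\<^sub>h \<ge> 6\<close> gives the strict inequality.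

  That the constructions do give matrix factorizations is block matrix multiplication together with
  the mixed-product rule \<open>(A \<otimes> B) (C \<otimes> D) = AC \<otimes> BD\<close> (lemma \<open>kronecker_mult\<close>).\<close>

section \<open>Kronecker products\<close>

lemma kronecker_carrier [simp, intro]:
  assumes "A \<in> carrier_mat a b" "B \<in> carrier_mat c d"
  shows "kronecker A B \<in> carrier_mat (a * c) (b * d)"
  using assms by (auto simp: kronecker_def)

lemma div_less_of_less_mult: "i div m < n" if "i < n * m" for i m n :: nat
  using that by (simp add: less_mult_imp_div_less)

lemma mod_less_of_less_mult: "i mod m < m" if "i < n * m" for i m n :: nat
  using that by (cases "m = 0") auto

lemma index_kronecker:
  assumes "A \<in> carrier_mat a b" "B \<in> carrier_mat c d" "i < a * c" "j < b * d"
  shows "kronecker A B $$ (i, j) = A $$ (i div c, j div d) * B $$ (i mod c, j mod d)"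
  using assms by (auto simp: kronecker_def)

lemma sum_div_mod:
  fixes f :: "nat \<Rightarrow> nat \<Rightarrow> 'a::comm_monoid_add"
  shows "(\<Sum>k = 0..<n * m. f (k div m) (k mod m)) = (\<Sum>i = 0..<n. \<Sum>j = 0..<m. f i j)"
proof -
  have "(\<Sum>i = 0..<n. \<Sum>j = 0..<m. f i j) = (\<Sum>(i, j)\<in>{0..<n} \<times> {0..<m}. f i j)"
    by (simp add: sum.cartesian_product)
  also have "\<dots> = (\<Sum>k = 0..<n * m. f (k div m) (k mod m))"
  proof (rule sum.reindex_bij_witness
      [where i = "\<lambda>k. (k div m, k mod m)" and j = "\<lambda>(i, j). i * m + j"])
    fix p assume p: "p \<in> {0..<n} \<times> {0..<m}"
    then obtain i j where ij: "p = (i, j)" "i < n" "j < m" by auto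
    have "i * m + j < (i + 1) * m" using ij by simp
    also have "\<dots> \<le> n * m" using ij by (intro mult_right_mono) auto
    finally show "(case p of (i, j) \<Rightarrow> i * m + j) \<in> {0..<n * m}" using ij by simp
  qed (auto simp: div_less_of_less_mult mod_less_of_less_mult)
  finally show ?thesis by simp
qed

lemma kronecker_mult:
  assumes A: "A \<in> carrier_mat a b" and B: "B \<in> carrier_mat p q"
    and C: "C \<in> carrier_mat b c" and D: "D \<in> carrier_mat q r"
  shows "kronecker A B * kronecker C D = kronecker (A * C) (B * D)"
proof (rule eq_matI)
  note AB = kronecker_carrier[OF A B] and CD = kronecker_carrier[OF C D]
  have AC: "A * C \<in> carrier_mat a c" and BD: "B * D \<in> carrier_mat p r"
    using A B C D by auto
  note K = kronecker_carrier[OF AC BD]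
  show "dim_row (kronecker A B * kronecker C D) = dim_row (kronecker (A * C) (B * D))"
    and "dim_col (kronecker A B * kronecker C D) = dim_col (kronecker (A * C) (B * D))"
    using AB CD K by auto
  fix i j
  assume "i < dim_row (kronecker (A * C) (B * D))" and "j < dim_col (kronecker (A * C) (B * D))"
  then have i: "i < a * p" and j: "j < c * r" using K by auto
  note bounds = div_less_of_less_mult[OF i] mod_less_of_less_mult[OF i]
    div_less_of_less_mult[OF j] mod_less_of_less_mult[OF j]
  have "(kronecker A B * kronecker C D) $$ (i, j)
      = (\<Sum>k = 0..<b * q. kronecker A B $$ (i, k) * kronecker C D $$ (k, j))"
    using AB CD i j by (auto simp: scalar_prod_def)
  also have "\<dots> = (\<Sum>k = 0..<b * q. A $$ (i div p, k div q) * C $$ (k div q, j div r)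
        * (B $$ (i mod p, k mod q) * D $$ (k mod q, j mod r)))"
    by (rule sum.cong)
      (simp_all add: index_kronecker[OF A B i] index_kronecker[OF C D _ j] mult_ac)
  also have "\<dots> = (\<Sum>s = 0..<b. \<Sum>t = 0..<q. A $$ (i div p, s) * C $$ (s, j div r)
        * (B $$ (i mod p, t) * D $$ (t, j mod r)))"
    by (rule sum_div_mod)
  also have "\<dots> = (A * C) $$ (i div p, j div r) * (B * D) $$ (i mod p, j mod r)"
    using A B C D bounds by (auto simp: scalar_prod_def sum_product)
  also have "\<dots> = kronecker (A * C) (B * D) $$ (i, j)"
    by (simp add: index_kronecker[OF AC BD i j])
  finally show "(kronecker A B * kronecker C D) $$ (i, j) = kronecker (A * C) (B * D) $$ (i, j)" .
qed

lemma kronecker_one: "kronecker (1\<^sub>m n) (1\<^sub>m m) = 1\<^sub>m (n * m)"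
proof (rule eq_matI)
  fix i j assume "i < dim_row (1\<^sub>m (n * m) :: 'a mat)" and "j < dim_col (1\<^sub>m (n * m) :: 'a mat)"
  then have i: "i < n * m" and j: "j < n * m" by auto
  have "i = j \<longleftrightarrow> i div m = j div m \<and> i mod m = j mod m"
    by (metis div_mult_mod_eq)
  then show "kronecker (1\<^sub>m n) (1\<^sub>m m) $$ (i, j) = (1\<^sub>m (n * m) :: 'a mat) $$ (i, j)"
    using i j div_less_of_less_mult[OF i] mod_less_of_less_mult[OF i]
      div_less_of_less_mult[OF j] mod_less_of_less_mult[OF j]
    by (auto simp: index_kronecker[OF one_carrier_mat one_carrier_mat i j])
qed (auto simp: kronecker_def)

lemma smult_smult_mat: "x \<cdot>\<^sub>m (y \<cdot>\<^sub>m A) = (x * y :: 'a::semigroup_mult) \<cdot>\<^sub>m A"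
  by (rule eq_matI) (auto simp: mult.assoc)

lemma kronecker_smult_left: "kronecker (x \<cdot>\<^sub>m A) B = x \<cdot>\<^sub>m kronecker A B"
  by (rule eq_matI)
    (auto simp: kronecker_def div_less_of_less_mult mod_less_of_less_mult mult_ac)

lemma kronecker_smult_right: "kronecker A (x \<cdot>\<^sub>m B) = x \<cdot>\<^sub>m kronecker A B"
  by (rule eq_matI)
    (auto simp: kronecker_def div_less_of_less_mult mod_less_of_less_mult mult_ac)

lemma kronecker_uminus_left: "kronecker (- A) B = - kronecker A B"
  by (rule eq_matI)
    (auto simp: kronecker_def div_less_of_less_mult mod_less_of_less_mult)

section \<open>The constructions give matrix factorizations\<close>

lemma smult_one_four_block_mat:
  "(x :: 'a::comm_ring_1) \<cdot>\<^sub>m 1\<^sub>m (2 * n)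
     = four_block_mat (x \<cdot>\<^sub>m 1\<^sub>m n) (0\<^sub>m n n) (0\<^sub>m n n) (x \<cdot>\<^sub>m 1\<^sub>m n)"
  by (rule eq_matI) (auto simp: four_block_mat_def)

lemma mult_tensor_matrix_factorization:
  assumes "matrix_factorization u n X" and "matrix_factorization v m Y"
  shows "matrix_factorization (u * v) (2 * (n * m)) (mult_tensor X Y)"
proof -
  obtain \<phi> \<psi> \<phi>' \<psi>' where XY: "X = (\<phi>, \<psi>)" "Y = (\<phi>', \<psi>')" by (cases X, cases Y) auto
  from assms have c: "\<phi> \<in> carrier_mat n n" "\<psi> \<in> carrier_mat n n"
      "\<phi>' \<in> carrier_mat m m" "\<psi>' \<in> carrier_mat m m"
    and e: "\<phi> * \<psi> = u \<cdot>\<^sub>m 1\<^sub>m n" "\<psi> * \<phi> = u \<cdot>\<^sub>m 1\<^sub>m n" "\<phi>' * \<psi>' = v \<cdot>\<^sub>m 1\<^sub>m m" "\<psi>' * \<phi>' = v \<cdot>\<^sub>m 1\<^sub>m m"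
    by (auto simp: matrix_factorization_def XY)
  have block: "four_block_mat A (0\<^sub>m (n * m) (n * m)) (0\<^sub>m (n * m) (n * m)) A
      * four_block_mat B (0\<^sub>m (n * m) (n * m)) (0\<^sub>m (n * m) (n * m)) B
      = (u * v) \<cdot>\<^sub>m 1\<^sub>m (2 * (n * m))"
    if "A \<in> carrier_mat (n * m) (n * m)" "B \<in> carrier_mat (n * m) (n * m)"
      "A * B = (u * v) \<cdot>\<^sub>m 1\<^sub>m (n * m)" for A B
    using that by (subst mult_four_block_mat) (auto simp: smult_one_four_block_mat)
  have "kronecker \<phi> \<phi>' * kronecker \<psi> \<psi>' = (u * v) \<cdot>\<^sub>m 1\<^sub>m (n * m)"
    and "kronecker \<psi> \<psi>' * kronecker \<phi> \<phi>' = (u * v) \<cdot>\<^sub>m 1\<^sub>m (n * m)"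
    by (simp_all add: kronecker_mult[OF c(1,3,2,4)] kronecker_mult[OF c(2,4,1,3)] e
        kronecker_smult_left kronecker_smult_right kronecker_one smult_smult_mat mult.commute)
  moreover note kronecker_carrier[OF c(1,3)] kronecker_carrier[OF c(2,4)]
  ultimately show ?thesis
    using c by (auto simp: matrix_factorization_def XY mult_tensor_def block Let_def mult_2
        intro!: four_block_carrier_mat)
qed

text \<open>The common shape of one step of the standard method and of Yoshino's product: the diagonal
  blocks factor \<open>u\<close>, the off-diagonal blocks factor \<open>v\<close>. Since the two pairs commute, the
  sign of one off-diagonal block in each matrix makes the mixed terms cancel, and it
  leaves \<open>u + v\<close> on the diagonal.\<close>

lemma four_block_matrix_factorization:
  fixes u v :: "'a::comm_ring_1"
  assumes c: "A \<in> carrier_mat n n" "B \<in> carrier_mat n n" "P \<in> carrier_mat n n" "Q \<in> carrier_mat n n"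
    and AB: "A * B = u \<cdot>\<^sub>m 1\<^sub>m n" "B * A = u \<cdot>\<^sub>m 1\<^sub>m n"
    and PQ: "P * Q = v \<cdot>\<^sub>m 1\<^sub>m n" "Q * P = v \<cdot>\<^sub>m 1\<^sub>m n"
    and comm: "A * P = P * A" "B * P = P * B" "A * Q = Q * A" "B * Q = Q * B"
  shows "matrix_factorization (u + v) (2 * n)
    (four_block_mat A P (- Q) B, four_block_mat B (- P) Q A)"
proof -
  have uv: "u \<cdot>\<^sub>m 1\<^sub>m n + v \<cdot>\<^sub>m 1\<^sub>m n = (u + v) \<cdot>\<^sub>m 1\<^sub>m n" "v \<cdot>\<^sub>m 1\<^sub>m n + u \<cdot>\<^sub>m 1\<^sub>m n = (u + v) \<cdot>\<^sub>m 1\<^sub>m n"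
    by (auto simp: add_smult_distrib_right_mat algebra_simps intro!: eq_matI)
  have minus: "- P * Q = - (P * Q)" "P * - Q = - (P * Q)" "- Q * P = - (Q * P)" "Q * - P = - (Q * P)"
      "A * - P = - (A * P)" "- Q * B = - (Q * B)" "B * - P = - (B * P)" "- Q * A = - (Q * A)"
      "- P * - Q = P * Q" "- Q * - P = Q * P" "B * - Q = - (B * Q)" "A * - Q = - (A * Q)"
      "- P * A = - (P * A)" "- P * B = - (P * B)"
    using c by auto
  have cancel: "- M + M = 0\<^sub>m n n" "M + - M = 0\<^sub>m n n" if "M \<in> carrier_mat n n" for M :: "'a mat"
    using that by (auto intro!: eq_matI)
  have "four_block_mat A P (- Q) B * four_block_mat B (- P) Q A = (u + v) \<cdot>\<^sub>m 1\<^sub>m (2 * n)"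
    using c by (subst mult_four_block_mat)
      (auto simp: minus AB PQ comm uv cancel smult_one_four_block_mat)
  moreover have "four_block_mat B (- P) Q A * four_block_mat A P (- Q) B = (u + v) \<cdot>\<^sub>m 1\<^sub>m (2 * n)"
    using c by (subst mult_four_block_mat)
      (auto simp: minus AB PQ comm uv cancel smult_one_four_block_mat)
  ultimately show ?thesis
    using c by (auto simp: matrix_factorization_def mult_2 intro!: four_block_carrier_mat)
qed

lemma yoshino_tensor_matrix_factorization:
  assumes "matrix_factorization u n X" and "matrix_factorization v m Y"
  shows "matrix_factorization (u + v) (2 * (n * m)) (yoshino_tensor X Y)"
proof -
  obtain \<phi> \<psi> \<phi>' \<psi>' where XY: "X = (\<phi>, \<psi>)" "Y = (\<phi>', \<psi>')" by (cases X, cases Y) auto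
  from assms have c: "\<phi> \<in> carrier_mat n n" "\<psi> \<in> carrier_mat n n"
      "\<phi>' \<in> carrier_mat m m" "\<psi>' \<in> carrier_mat m m"
    and e: "\<phi> * \<psi> = u \<cdot>\<^sub>m 1\<^sub>m n" "\<psi> * \<phi> = u \<cdot>\<^sub>m 1\<^sub>m n" "\<phi>' * \<psi>' = v \<cdot>\<^sub>m 1\<^sub>m m" "\<psi>' * \<phi>' = v \<cdot>\<^sub>m 1\<^sub>m m"
    by (auto simp: matrix_factorization_def XY)
  note mult = kronecker_mult[of _ n n _ m m _ n _ m]
  have "matrix_factorization (u + v) (2 * (n * m))
      (four_block_mat (kronecker \<phi> (1\<^sub>m m)) (kronecker (1\<^sub>m n) \<phi>')
         (- kronecker (1\<^sub>m n) \<psi>') (kronecker \<psi> (1\<^sub>m m)),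
       four_block_mat (kronecker \<psi> (1\<^sub>m m)) (- kronecker (1\<^sub>m n) \<phi>')
         (kronecker (1\<^sub>m n) \<psi>') (kronecker \<phi> (1\<^sub>m m)))"
    using c by (intro four_block_matrix_factorization)
      (auto simp: mult e kronecker_smult_left kronecker_smult_right kronecker_one)
  then show ?thesis
    using c by (simp add: XY yoshino_tensor_def Let_def kronecker_uminus_left)
qed

lemma standard_step_matrix_factorization:
  assumes "matrix_factorization u n X"
  shows "matrix_factorization (u + a * b) (2 * n) (standard_step X (a, b))"
proof -
  obtain C D where X: "X = (C, D)" by (cases X) auto
  from assms have c: "C \<in> carrier_mat n n" "D \<in> carrier_mat n n"
    and e: "C * D = u \<cdot>\<^sub>m 1\<^sub>m n" "D * C = u \<cdot>\<^sub>m 1\<^sub>m n"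
    by (auto simp: matrix_factorization_def X)
  have neg: "- (x \<cdot>\<^sub>m 1\<^sub>m n) = - x \<cdot>\<^sub>m 1\<^sub>m n" "- (- x \<cdot>\<^sub>m 1\<^sub>m n) = x \<cdot>\<^sub>m 1\<^sub>m n" for x :: 'a
    by (auto intro!: eq_matI)
  have scal: "M * (x \<cdot>\<^sub>m 1\<^sub>m n) = x \<cdot>\<^sub>m M" "x \<cdot>\<^sub>m 1\<^sub>m n * M = x \<cdot>\<^sub>m M"
    if "M \<in> carrier_mat n n" for x :: 'a and M
    using that by (auto simp: mult_smult_distrib[of _ n n] mult_smult_assoc_mat[of _ n n])
  (* The standard step uses the factorization (-a) (-b) of a b as the commuting pair. *)
  have "matrix_factorization (u + a * b) (2 * n)
      (four_block_mat C (- a \<cdot>\<^sub>m 1\<^sub>m n) (- (- b \<cdot>\<^sub>m 1\<^sub>m n)) D,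
       four_block_mat D (- (- a \<cdot>\<^sub>m 1\<^sub>m n)) (- b \<cdot>\<^sub>m 1\<^sub>m n) C)"
    using c by (intro four_block_matrix_factorization)
      (auto simp: scal e smult_smult_mat mult_ac)
  then show ?thesis
    using c by (simp add: X standard_step_def Let_def neg)
qed

lemma factorization_1x1_matrix_factorization:
  fixes a b :: "'a::comm_ring_1"
  shows "matrix_factorization (a * b) 1 (factorization_1x1 a b)"
  by (auto simp: matrix_factorization_def factorization_1x1_def scalar_prod_def mult_ac
      intro!: eq_matI)

lemma standard_matrices_matrix_factorization:
  fixes ps :: "('a::comm_ring_1 \<times> 'a) list"
  assumes "ps \<noteq> []"
  shows "matrix_factorization (\<Sum>(a, b)\<leftarrow>ps. a * b) (2 ^ (length ps - 1)) (standard_matrices ps)"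
proof -
  have fold: "matrix_factorization (u + (\<Sum>(a, b)\<leftarrow>qs. a * b)) (2 ^ length qs * n)
      (foldl standard_step X qs)"
    if "matrix_factorization u n X" for u :: 'a and n X and qs
    using that
  proof (induction qs arbitrary: u n X)
    case (Cons p qs)
    obtain a b where p: "p = (a, b)" by (cases p)
    show ?case
      using Cons.IH[OF standard_step_matrix_factorization[OF Cons.prems, of a b]]
      by (simp add: p algebra_simps)
  qed simp
  obtain p qs where ps: "ps = p # qs" using assms by (cases ps) auto
  show ?thesis
    using fold[OF factorization_1x1_matrix_factorization[of "fst p" "snd p"], of qs]
    by (simp add: ps standard_matrices_def split_beta)
qed

lemma foldl_yoshino_tensor_matrix_factorization:
  assumes "matrix_factorization u (2 ^ d) X"
    and "list_all2 (\<lambda>p Y. matrix_factorization (v p) (2 ^ e p) Y) ps Ys"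
  shows "matrix_factorization (u + (\<Sum>p\<leftarrow>ps. v p)) (2 ^ (d + (\<Sum>p\<leftarrow>ps. Suc (e p))))
    (foldl yoshino_tensor X Ys)"
  using assms(2,1)
proof (induction arbitrary: u d X rule: list_all2_induct)
  case (Cons p ps Y Ys)
  have "matrix_factorization (u + v p) (2 ^ Suc (d + e p)) (yoshino_tensor X Y)"
    using yoshino_tensor_matrix_factorization[OF Cons.prems Cons.hyps(1)]
    by (simp add: power_add)
  from Cons.IH[OF this] show ?case by (simp add: algebra_simps)
qed simp

section \<open>Monomials and the two methods\<close>

lemma sum_mset_image_mset_set: "sum_mset (image_mset f (mset_set A)) = sum f A"
  by (simp add: sum_unfold_sum_mset)

lemma sum_term_of: "(\<Sum>m\<in>Poly_Mapping.keys g. term_of g m) = g"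
proof (rule poly_mapping_eqI)
  fix k
  have "Poly_Mapping.lookup (\<Sum>m\<in>Poly_Mapping.keys g. term_of g m) k
      = (\<Sum>m\<in>Poly_Mapping.keys g. if m = k then Poly_Mapping.lookup g m else 0)"
    by (simp add: term_of_def lookup_sum lookup_single when_def)
  then show "Poly_Mapping.lookup (\<Sum>m\<in>Poly_Mapping.keys g. term_of g m) k = Poly_Mapping.lookup g k"
    by (simp add: in_keys_iff)
qed

lemma sum_mset_monomials: "sum_mset (monomials g) = g"
  by (simp add: monomials_def sum_mset_image_mset_set sum_term_of)

lemma size_monomials: "size (monomials g) = num_monomials g"
  by (simp add: monomials_def num_monomials_def)

lemma sum_mset_product_monomials: "sum_mset (product_monomials g h) = g * h"
proof -
  have "sum_mset (product_monomials g h)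
      = (\<Sum>m\<in>Poly_Mapping.keys g. term_of g m) * (\<Sum>m\<in>Poly_Mapping.keys h. term_of h m)"
    by (simp add: product_monomials_def sum_mset_image_mset_set sum_product sum.cartesian_product)
  then show ?thesis by (simp add: sum_term_of)
qed

lemma size_product_monomials: "size (product_monomials g h) = num_monomials g * num_monomials h"
  by (simp add: product_monomials_def num_monomials_def card_cartesian_product)

lemma sum_mset_expanded_form: "sum_mset (expanded_form F) = (\<Sum>(g, h)\<leftarrow>F. g * h)"
  by (induction F) (auto simp: expanded_form_def sum_mset_product_monomials)

lemma size_expanded_form:
  "size (expanded_form F) = (\<Sum>(g, h)\<leftarrow>F. num_monomials g * num_monomials h)"
  by (induction F) (auto simp: expanded_form_def size_product_monomials)

lemma num_monomials_pos: "0 < num_monomials g" if "g \<noteq> 0"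
  using that by (simp add: num_monomials_def card_gt_0_iff)

lemma ex_standard_method: "\<exists>X. standard_method T X"
proof -
  obtain ts where "mset ts = T" using ex_mset by blast
  then have "mset (map (\<lambda>(a, b). a * b) (map (\<lambda>t. (t, 1)) ts)) = T"
    by (simp add: comp_def)
  then show ?thesis unfolding standard_method_def by blast
qed

lemma standard_method_matrix_factorization:
  assumes "standard_method T X" and "T \<noteq> {#}"
  shows "matrix_factorization (sum_mset T) (2 ^ (size T - 1)) X"
proof -
  obtain ps where T: "mset (map (\<lambda>(a, b). a * b) ps) = T" and X: "X = standard_matrices ps"
    using assms(1) by (auto simp: standard_method_def)
  have "ps \<noteq> []" using T assms(2) by auto
  moreover have "sum_mset T = (\<Sum>(a, b)\<leftarrow>ps. a * b)"
    by (simp only: T[symmetric] sum_mset_sum_list)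
  moreover have "size T = length ps" by (simp flip: T)
  ultimately show ?thesis using standard_matrices_matrix_factorization[of ps] by (simp add: X)
qed

text \<open>The binary logarithm of the size of the factorization of \<open>gh\<close>: when both factors are sums,
  this is \<open>(n\<^sub>g - 1) + (n\<^sub>h - 1)\<close> from the two standard factorizations, plus one because
  \<^const>\<open>mult_tensor\<close> doubles the size of the Kronecker product.\<close>

definition summand_exponent :: "'n mpoly \<times> 'n mpoly \<Rightarrow> nat" where
  "summand_exponent p = (case p of (g, h) \<Rightarrow>
     if num_monomials g \<ge> 2 \<and> num_monomials h \<ge> 2 then num_monomials g + num_monomials h - 1 else 0)"

lemma ex_summand_method: "\<exists>X. summand_method p X"
proof -
  obtain g h where "p = (g, h)" by (cases p)
  moreover obtain U V where "standard_method (monomials g) U" "standard_method (monomials h) V"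
    using ex_standard_method by meson
  ultimately have "summand_method p (if num_monomials g \<ge> 2 \<and> num_monomials h \<ge> 2
      then mult_tensor U V else factorization_1x1 g h)"
    by (auto simp: summand_method_def simp del: split_paired_Ex)
  then show ?thesis by blast
qed

lemma ex_improved_method:
  fixes F :: "('n mpoly \<times> 'n mpoly) list"
  shows "\<exists>X. improved_method F X"
proof -
  obtain s where "\<And>p :: 'n mpoly \<times> 'n mpoly. summand_method p (s p)" using ex_summand_method by metis
  then have "list_all2 summand_method F (map s F)" by (auto simp: list_all2_conv_all_nth)
  then show ?thesis unfolding improved_method_def by blast
qed

lemma summand_method_matrix_factorization:
  assumes "summand_method p X"
  shows "matrix_factorization (fst p * snd p) (2 ^ summand_exponent p) X"
proof -
  obtain g h where p: "p = (g, h)" by (cases p)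
  show ?thesis
  proof (cases "num_monomials g \<ge> 2 \<and> num_monomials h \<ge> 2")
    case True
    then obtain U V where UV: "standard_method (monomials g) U" "standard_method (monomials h) V"
      and X: "X = mult_tensor U V"
      using assms by (auto simp: summand_method_def p)
    have ne: "monomials g \<noteq> {#}" "monomials h \<noteq> {#}"
      using True size_monomials[of g] size_monomials[of h] by auto
    from True obtain k l where kl: "num_monomials g = Suc k" "num_monomials h = Suc l"
      by (metis Suc_le_D numeral_2_eq_2)
    show ?thesis
      using mult_tensor_matrix_factorization[OF standard_method_matrix_factorization[OF UV(1) ne(1)]
          standard_method_matrix_factorization[OF UV(2) ne(2)]] True
      by (simp add: p X sum_mset_monomials size_monomials summand_exponent_def kl power_add)
  next
    case False
    then show ?thesis
      using assms factorization_1x1_matrix_factorization[of g h]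
      by (auto simp: summand_method_def p summand_exponent_def)
  qed
qed

lemma improved_method_matrix_factorization:
  assumes "improved_method F X" and "F \<noteq> []"
  shows "matrix_factorization (\<Sum>(g, h)\<leftarrow>F. g * h) (2 ^ ((\<Sum>p\<leftarrow>F. Suc (summand_exponent p)) - 1)) X"
proof -
  obtain Xs where "list_all2 summand_method F Xs" and X: "X = foldl yoshino_tensor (hd Xs) (tl Xs)"
    using assms(1) by (auto simp: improved_method_def)
  then have Xs: "list_all2 (\<lambda>p Y. matrix_factorization (fst p * snd p) (2 ^ summand_exponent p) Y) F Xs"
    by (auto elim!: list_all2_mono summand_method_matrix_factorization)
  obtain p F' where F: "F = p # F'" using assms(2) by (cases F) auto
  then obtain Y Ys where Ys: "Xs = Y # Ys" using Xs by (cases Xs) auto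
  show ?thesis
    using foldl_yoshino_tensor_matrix_factorization[of _ _ Y _ summand_exponent F' Ys] Xs
    by (auto simp: F Ys X split_beta)
qed

section \<open>Comparison of the sizes\<close>

lemma Suc_summand_exponent_le:
  assumes "g \<noteq> 0" and "h \<noteq> 0"
  shows "Suc (summand_exponent (g, h)) \<le> num_monomials g * num_monomials h"
proof (cases "num_monomials g \<ge> 2 \<and> num_monomials h \<ge> 2")
  case True
  then obtain k l where "num_monomials g = k + 2" "num_monomials h = l + 2"
    by (metis add.commute le_Suc_ex)
  then show ?thesis by (simp add: summand_exponent_def algebra_simps)
next
  case False
  then show ?thesis
    using num_monomials_pos[OF assms(1)] num_monomials_pos[OF assms(2)]
    by (auto simp: summand_exponent_def)
qed

lemma Suc_summand_exponent_less:
  assumes "6 \<le> num_monomials g * num_monomials h"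
  shows "Suc (summand_exponent (g, h)) < num_monomials g * num_monomials h"
proof (cases "num_monomials g \<ge> 2 \<and> num_monomials h \<ge> 2")
  case True
  then obtain k l where kl: "num_monomials g = k + 2" "num_monomials h = l + 2"
    by (metis add.commute le_Suc_ex)
  (* In terms of k and l the claim is 0 < k * l + k + l. *)
  with assms have "k \<noteq> 0 \<or> l \<noteq> 0" by auto
  with kl show ?thesis by (auto simp: summand_exponent_def algebra_simps)
next
  case False
  then show ?thesis using assms by (auto simp: summand_exponent_def)
qed

lemma sum_list_strict_mono_one:
  fixes f g :: "'a \<Rightarrow> nat"
  assumes "\<And>x. x \<in> set xs \<Longrightarrow> f x \<le> g x" and "y \<in> set xs" and "f y < g y"
  shows "(\<Sum>x\<leftarrow>xs. f x) < (\<Sum>x\<leftarrow>xs. g x)"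
proof -
  obtain us vs where xs: "xs = us @ y # vs" using assms(2) by (meson split_list)
  have "(\<Sum>x\<leftarrow>us. f x) \<le> (\<Sum>x\<leftarrow>us. g x)" "(\<Sum>x\<leftarrow>vs. f x) \<le> (\<Sum>x\<leftarrow>vs. g x)"
    using assms(1) by (auto simp: xs intro!: sum_list_mono)
  with assms(3) show ?thesis by (simp add: xs)
qed

lemma sum_summand_exponent_less:
  assumes "simple_summand_reduced_form f F"
  shows "(\<Sum>p\<leftarrow>F. Suc (summand_exponent p)) < size (expanded_form F)"
proof -
  have nz: "\<And>g h. (g, h) \<in> set F \<Longrightarrow> g \<noteq> 0 \<and> h \<noteq> 0"
    and "\<exists>(g, h)\<in>set F. 6 \<le> num_monomials g * num_monomials h"
    using assms unfolding simple_summand_reduced_form_def by auto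
  then obtain g h where gh: "(g, h) \<in> set F" "6 \<le> num_monomials g * num_monomials h" by auto
  show ?thesis
    unfolding size_expanded_form
    by (rule sum_list_strict_mono_one[OF _ gh(1)])
      (use nz Suc_summand_exponent_le Suc_summand_exponent_less[OF gh(2)] in auto)
qed

theorem theorem4p1:
  fixes f :: "'n::finite mpoly"
  assumes "simple_summand_reducible f"
  shows "(\<exists>F. simple_summand_reduced_form f F) \<and>
    (\<forall>F. simple_summand_reduced_form f F \<longrightarrow>
       (\<exists>X. improved_method F X) \<and>
       (\<exists>Y. standard_method (expanded_form F) Y) \<and>
       (\<forall>X Y. improved_method F X \<and> standard_method (expanded_form F) Y \<longrightarrow>
          (\<exists>N M. matrix_factorization f N X \<and> matrix_factorization f M Y \<and>
                 real N \<le> 1 / 2 * real M)))"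
proof (intro conjI allI impI ex_improved_method ex_standard_method)
  show "\<exists>F. simple_summand_reduced_form f F"
    using assms by (simp add: simple_summand_reducible_def)
next
  fix F X Y
  assume F: "simple_summand_reduced_form f F"
    and XY: "improved_method F X \<and> standard_method (expanded_form F) Y"
  define e where "e = (\<Sum>p\<leftarrow>F. Suc (summand_exponent p))"
  define d where "d = size (expanded_form F)"
  have ne: "F \<noteq> []" and f: "f = (\<Sum>(g, h)\<leftarrow>F. g * h)"
    using F by (auto simp: simple_summand_reduced_form_def)
  have "e < d"
    using sum_summand_exponent_less[OF F] by (simp add: e_def d_def)
  moreover have "0 < e"
    using ne by (cases F) (auto simp: e_def)
  ultimately have "e - 1 + 1 \<le> d - 1" by simp
  then have "(2::real) ^ (e - 1 + 1) \<le> 2 ^ (d - 1)"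
    by (rule power_increasing) simp
  then have "real (2 ^ (e - 1)) \<le> 1 / 2 * real (2 ^ (d - 1))" by simp
  moreover have "matrix_factorization f (2 ^ (e - 1)) X"
    using improved_method_matrix_factorization[OF _ ne] XY by (simp add: f e_def)
  moreover have "expanded_form F \<noteq> {#}" using \<open>e < d\<close> by (auto simp: d_def)
  then have "matrix_factorization f (2 ^ (d - 1)) Y"
    using standard_method_matrix_factorization XY
    by (metis d_def f sum_mset_expanded_form)
  ultimately show "\<exists>N M. matrix_factorization f N X \<and> matrix_factorization f M Y \<and>
      real N \<le> 1 / 2 * real M" by blast
qed

end
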